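(* Let $\{\varphi_n\}_{n=1}^N$ be a unit norm tight frame for $\mathbb{R}^M$ which is invariant under the action of the group of $M\times M$ signed permutation matrices. Let $0<\varepsilon<1$, let $L\ge 2$ be an integer such that $(L-1)(1-\varepsilon^2)^L\le\frac{1}{M}\bigl(\frac{L-1}{L}\bigr)^L$, let $\delta=[M(L-1)]^{-\frac{1}{2L}}$, and let $\{\psi_r\}_{r=1}^R$, $R=\binom{M+L-1}{L-1}$, be the collection $\mathbb{S}_{\mathrm{nn}}^{M-1}(L,\delta)$ of normalized step functions. Then for any integer $K$ with $M\le K\le N$, the optimal NERF bounds $\alpha_K,\beta_K$ of $\{\varphi_n\}_{n=1}^N$ satisfy $$\tfrac{1}{1-\varepsilon^2}\Bigl(\alpha_{K,\varepsilon}-\varepsilon^2\min\bigl\{\tfrac{N}{M},\tfrac{1}{1-\varepsilon^2}\beta_{K,\varepsilon}\bigr\}\Bigr)\le\alpha_K\le\alpha_{K,\varepsilon},\qquad \beta_{K,\varepsilon}\le\beta_K\le\min\bigl\{\tfrac{N}{M},\tfrac{1}{1-\varepsilon^2}\beta_{K,\varepsilon}\bigr\},$$ where $\alpha_{K,\varepsilon}$ and $\beta_{K,\varepsilon}$ are found as follows: for each $r=1,\dots,R$, let $\alpha_{K,\varepsilon,r}$ and $\beta_{K,\varepsilon,r}$ be the sums of the $K$ smallest and of the $K$ largest values (counted with multiplicity) of $\{|\langle\psi_r,\varphi_n\rangle|^2\}_{n=1}^N$, respectively; let $\alpha_{K,\varepsilon}=\min_r\alpha_{K,\varepsilon,r}$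 and $\beta_{K,\varepsilon}=\max_r\beta_{K,\varepsilon,r}$.
   Context: $\mathbb{R}^M$ carries the standard inner product $\langle\cdot,\cdot\rangle$ and norm $\|\cdot\|$. A family $\{\varphi_n\}_{n=1}^N\subseteq\mathbb{R}^M$ is a unit norm tight frame if $\|\varphi_n\|=1$ for all $n$ and $\sum_{n=1}^N\varphi_n\varphi_n^*=A\,\mathrm{I}$ for some $A>0$. A signed permutation matrix is a product of a permutation matrix and a diagonal matrix with diagonal entries $\pm1$. The family $\{\varphi_n\}_{n=1}^N$ is invariant under the group of $M\times M$ signed permutation matrices if for every such matrix $U$ there exists a permutation $\sigma$ of $\{1,\dots,N\}$ such that $U\varphi_n=\pm\varphi_{\sigma(n)}$ for all $n=1,\dots,N$ (the sign may depend on $U$ and $n$). The collection $\mathbb{S}_{\mathrm{nn}}^{M-1}(L,\delta)$ consists of the unit vectors $\psi=\hat\psi/\|\hat\psi\|$ where $\hat\psi:\{1,\dots,M\}\to\{\delta^l\}_{l=0}^{L-1}$ satisfies $\hat\psi(1)\le\cdots\le\hat\psi(M)$. It is enumerated as a family (possibly with repetitions) indexed by the $\binom{M+L-1}{L-1}$ nonincreasing functions $\eta:\{1,\dots,M\}\to\{0,\dots,L-1\}$, via $\hat\psi(m)=\delta^{\eta(m)}$. The optimal lower and upper NERF (numerically erasure-robust frame) bounds of $\{\varphi_n\}_{n=1}^N$ are $$\alpha_K:=\min_{|\mathcal{K}|=K}\ \min_{\|x\|=1}\sum_{n\in\mathcal{K}}|\langle x,\varphi_n\rangle|^2,\qquad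 \beta_K:=\max_{|\mathcal{K}|=K}\ \max_{\|x\|=1}\sum_{n\in\mathcal{K}}|\langle x,\varphi_n\rangle|^2,$$ where $\mathcal{K}$ ranges over all $K$-element subsets of $\{1,\dots,N\}$ and $x$ over $\mathbb{R}^M$. *)

theory Defs
  imports "HOL-Analysis.Analysis"
begin

definition unit_norm_tight_frame :: "nat \<Rightarrow> (nat \<Rightarrow> real ^ 'm) \<Rightarrow> bool" where
  "unit_norm_tight_frame N \<phi> \<longleftrightarrow>
     (\<forall>n\<in>{1..N}. norm (\<phi> n) = 1) \<and>
     (\<exists>A>0. (\<Sum>n = 1..N. columnvector (\<phi> n) ** (rowvector (\<phi> n) :: real ^ 'm ^ 1)) =
        A *\<^sub>R mat 1)"

definition permutation_matrix :: "real ^ 'm ^ 'm \<Rightarrow> bool" where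
  "permutation_matrix P \<longleftrightarrow>
     (\<exists>p. p permutes UNIV \<and> P = (\<chi> i j. if i = p j then 1 else 0))"

definition sign_diagonal_matrix :: "real ^ 'm ^ 'm \<Rightarrow> bool" where
  "sign_diagonal_matrix D \<longleftrightarrow>
     (\<forall>i j. i \<noteq> j \<longrightarrow> D $ i $ j = 0) \<and> (\<forall>i. D $ i $ i = 1 \<or> D $ i $ i = - 1)"

definition signed_permutation_matrix :: "real ^ 'm ^ 'm \<Rightarrow> bool" where
  "signed_permutation_matrix U \<longleftrightarrow>
     (\<exists>P D. permutation_matrix P \<and> sign_diagonal_matrix D \<and> U = P ** D)"

definition signed_permutation_invariant :: "nat \<Rightarrow> (nat \<Rightarrow> real ^ 'm) \<Rightarrow> bool" where
  "signed_permutation_invariant N \<phi> \<longleftrightarrow>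
     (\<forall>U. signed_permutation_matrix U \<longrightarrow>
        (\<exists>\<sigma>. \<sigma> permutes {1..N} \<and>
          (\<forall>n\<in>{1..N}. U *v \<phi> n = \<phi> (\<sigma> n) \<or> U *v \<phi> n = - \<phi> (\<sigma> n))))"

(* The coordinate index set {1,...,M} is a finite linearly ordered type 'm with CARD('m) = M;
   up to order isomorphism there is exactly one such type for each M >= 1. *)

definition step_exponents :: "nat \<Rightarrow> ('m::{finite,linorder} \<Rightarrow> nat) set" where
  "step_exponents L = {\<eta>. antimono \<eta> \<and> range \<eta> \<subseteq> {0..L - 1}}"

definition normalized_step :: "real \<Rightarrow> ('m \<Rightarrow> nat) \<Rightarrow> real ^ 'm" where
  "normalized_step \<delta> \<eta> = (let h = (\<chi> m. \<delta> ^ \<eta> m) in h /\<^sub>R norm h)"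

(* Different exponent functions may give the same unit vector, so the collection is a family
   indexed by the exponent functions and not a set. The order of enumeration is arbitrary; an enumeration with
   R = (CARD('m) + L - 1) choose (L - 1) exists (ex_step_collection below). *)

definition step_collection ::
    "nat \<Rightarrow> real \<Rightarrow> nat \<Rightarrow> (nat \<Rightarrow> real ^ 'm::{finite,linorder}) \<Rightarrow> bool" where
  "step_collection L \<delta> R \<psi> \<longleftrightarrow>
     (\<exists>\<eta>. bij_betw \<eta> {1..R} (step_exponents L) \<and>
        (\<forall>r\<in>{1..R}. \<psi> r = normalized_step \<delta> (\<eta> r)))"

(* The infimum and supremum over the unit sphere are attained: see nerf_inf_attained and
   nerf_sup_attained below. *)

definition nerf_lower :: "nat \<Rightarrow> (nat \<Rightarrow> real ^ 'm) \<Rightarrow> nat \<Rightarrow> real" where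
  "nerf_lower N \<phi> K =
     Min ((\<lambda>\<K>. INF x\<in>sphere 0 1. \<Sum>n\<in>\<K>. \<bar>x \<bullet> \<phi> n\<bar>\<^sup>2) ` {\<K>. \<K> \<subseteq> {1..N} \<and> card \<K> = K})"

definition nerf_upper :: "nat \<Rightarrow> (nat \<Rightarrow> real ^ 'm) \<Rightarrow> nat \<Rightarrow> real" where
  "nerf_upper N \<phi> K =
     Max ((\<lambda>\<K>. SUP x\<in>sphere 0 1. \<Sum>n\<in>\<K>. \<bar>x \<bullet> \<phi> n\<bar>\<^sup>2) ` {\<K>. \<K> \<subseteq> {1..N} \<and> card \<K> = K})"

definition sum_smallest :: "nat \<Rightarrow> real list \<Rightarrow> real" where
  "sum_smallest K xs = sum_list (take K (sort xs))"

definition sum_largest :: "nat \<Rightarrow> real list \<Rightarrow> real" where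
  "sum_largest K xs = sum_list (take K (rev (sort xs)))"

definition nerf_lower_est ::
    "nat \<Rightarrow> (nat \<Rightarrow> real ^ 'm) \<Rightarrow> nat \<Rightarrow> (nat \<Rightarrow> real ^ 'm) \<Rightarrow> nat \<Rightarrow> real" where
  "nerf_lower_est N \<phi> R \<psi> K =
     Min ((\<lambda>r. sum_smallest K (map (\<lambda>n. \<bar>\<psi> r \<bullet> \<phi> n\<bar>\<^sup>2) [1..<Suc N])) ` {1..R})"

definition nerf_upper_est ::
    "nat \<Rightarrow> (nat \<Rightarrow> real ^ 'm) \<Rightarrow> nat \<Rightarrow> (nat \<Rightarrow> real ^ 'm) \<Rightarrow> nat \<Rightarrow> real" where
  "nerf_upper_est N \<phi> R \<psi> K =
     Max ((\<lambda>r. sum_largest K (map (\<lambda>n. \<bar>\<psi> r \<bullet> \<phi> n\<bar>\<^sup>2) [1..<Suc N])) ` {1..R})"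

lemma nerf_inf_attained:
  fixes \<phi> :: "nat \<Rightarrow> real ^ 'm"
  shows "\<exists>x\<in>sphere 0 1. (INF x\<in>sphere 0 1. \<Sum>n\<in>\<K>. \<bar>x \<bullet> \<phi> n\<bar>\<^sup>2) = (\<Sum>n\<in>\<K>. \<bar>x \<bullet> \<phi> n\<bar>\<^sup>2)"
proof -
  let ?f = "\<lambda>x. \<Sum>n\<in>\<K>. \<bar>x \<bullet> \<phi> n\<bar>\<^sup>2"
  have "continuous_on (sphere 0 1) ?f" by (intro continuous_intros)
  then obtain x where "x \<in> sphere 0 1" "\<forall>y\<in>sphere 0 1. ?f x \<le> ?f y"
    using continuous_attains_inf[of "sphere (0 :: real ^ 'm) 1" ?f] by auto
  then show ?thesis
    by (intro bexI[of _ x] cInf_eq_minimum) auto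
qed

lemma nerf_sup_attained:
  fixes \<phi> :: "nat \<Rightarrow> real ^ 'm"
  shows "\<exists>x\<in>sphere 0 1. (SUP x\<in>sphere 0 1. \<Sum>n\<in>\<K>. \<bar>x \<bullet> \<phi> n\<bar>\<^sup>2) = (\<Sum>n\<in>\<K>. \<bar>x \<bullet> \<phi> n\<bar>\<^sup>2)"
proof -
  let ?f = "\<lambda>x. \<Sum>n\<in>\<K>. \<bar>x \<bullet> \<phi> n\<bar>\<^sup>2"
  have "continuous_on (sphere 0 1) ?f" by (intro continuous_intros)
  then obtain x where "x \<in> sphere 0 1" "\<forall>y\<in>sphere 0 1. ?f y \<le> ?f x"
    using continuous_attains_sup[of "sphere (0 :: real ^ 'm) 1" ?f] by auto
  then show ?thesis
    by (intro bexI[of _ x] cSup_eq_maximum) auto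
qed

lemma card_step_exponents:
  assumes "1 \<le> L"
  shows "card (step_exponents L :: ('m::{finite,linorder} \<Rightarrow> nat) set) = (CARD('m) + L - 1) choose (L - 1)"
proof -
  define xs where "xs = sorted_list_of_set (UNIV :: 'm set)"
  have xs: "set xs = UNIV" "sorted xs" "distinct xs" "length xs = CARD('m)"
    by (auto simp: xs_def)
  define F where "F = (\<lambda>\<eta> :: 'm \<Rightarrow> nat. mset (map \<eta> xs))"
  have sorted_F: "map \<eta> xs = rev (sorted_list_of_multiset (F \<eta>))" if "antimono \<eta>" for \<eta> :: "'m \<Rightarrow> nat"
  proof -
    have "sorted (rev (map \<eta> xs))"
      unfolding sorted_rev_iff_nth_mono
      using xs(2) that by (auto simp: sorted_iff_nth_mono antimono_def)
    then have "sorted_list_of_multiset (mset (rev (map \<eta> xs))) = rev (map \<eta> xs)"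
      by (simp only: sorted_list_of_multiset_mset sorted_sort_id)
    then show ?thesis by (simp add: F_def)
  qed
  have "inj_on F (step_exponents L)"
  proof (rule inj_onI)
    fix \<eta> \<theta> assume "\<eta> \<in> step_exponents L" "\<theta> \<in> step_exponents L" "F \<eta> = F \<theta>"
    then have "map \<eta> xs = map \<theta> xs"
      using sorted_F[of \<eta>] sorted_F[of \<theta>] by (simp add: step_exponents_def)
    then show "\<eta> = \<theta>" using xs(1) by auto
  qed
  moreover have "F ` step_exponents L = multisets_of_size {0..L - 1} (CARD('m))"
  proof (intro equalityI subsetI)
    fix X assume "X \<in> F ` step_exponents L"
    then show "X \<in> multisets_of_size {0..L - 1} (CARD('m))"
      using xs by (auto simp: F_def step_exponents_def multisets_of_size_def)
  next
    fix X :: "nat multiset" assume X: "X \<in> multisets_of_size {0..L - 1} (CARD('m))"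
    define ys where "ys = rev (sorted_list_of_multiset X)"
    have ys: "length ys = length xs" "set ys \<subseteq> {0..L - 1}" "sorted (rev ys)" "mset ys = X"
      using X xs by (auto simp: ys_def multisets_of_size_def size_mset[symmetric] simp del: size_mset)
    define \<eta> where "\<eta> x = the (map_of (zip xs ys) x)" for x
    have nth: "\<eta> (xs ! i) = ys ! i" if "i < length xs" for i
      using that xs ys by (simp add: \<eta>_def map_of_zip_nth)
    have mp: "map \<eta> xs = ys" using nth ys(1) by (auto intro: nth_equalityI)
    have "antimono \<eta>"
    proof (rule antimonoI)
      fix x y :: 'm assume "x \<le> y"
      obtain i j where ij: "x = xs ! i" "i < length xs" "y = xs ! j" "j < length xs"
        using xs(1) by (metis UNIV_I in_set_conv_nth)
      show "\<eta> y \<le> \<eta> x"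
      proof (cases "i \<le> j")
        case True
        then show ?thesis using ij nth ys(1,3) by (simp add: sorted_rev_iff_nth_mono)
      next
        case False
        then have "y \<le> x" using ij xs(2) by (simp add: sorted_iff_nth_mono)
        with \<open>x \<le> y\<close> show ?thesis by simp
      qed
    qed
    moreover have "range \<eta> \<subseteq> {0..L - 1}" using mp ys(2) xs(1) by (metis set_map)
    ultimately have "\<eta> \<in> step_exponents L" by (simp add: step_exponents_def)
    moreover have "F \<eta> = X" using mp ys(4) by (simp only: F_def)
    ultimately show "X \<in> F ` step_exponents L" by blast
  qed
  ultimately have "card (step_exponents L :: ('m \<Rightarrow> nat) set) = card (multisets_of_size {0..L - 1} (CARD('m)))"
    by (metis card_image)
  also have "\<dots> = (CARD('m) + L - 1) choose CARD('m)"
    using assms by (simp add: card_multisets_of_size add.commute)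
  also have "\<dots> = (CARD('m) + L - 1) choose (L - 1)"
    using assms by (subst binomial_symmetric) auto
  finally show ?thesis .
qed

lemma ex_step_collection:
  assumes "1 \<le> L"
  shows "\<exists>\<psi> :: nat \<Rightarrow> real ^ 'm::{finite,linorder}.
           step_collection L \<delta> ((CARD('m) + L - 1) choose (L - 1)) \<psi>"
proof -
  let ?S = "step_exponents L :: ('m \<Rightarrow> nat) set"
  have "card ?S > 0" using assms by (simp add: card_step_exponents)
  then have "finite ?S" by (rule card_ge_0_finite)
  then obtain \<eta> where "bij_betw \<eta> {1..card ?S} ?S"
    using ex_bij_betw_nat_finite_1 by blast
  then show ?thesis
    unfolding step_collection_def card_step_exponents[OF assms]
    by (intro exI[of _ "\<lambda>r. normalized_step \<delta> (\<eta> r)"] exI[of _ \<eta>]) auto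
qed

end

theory Submission
  imports Defs
begin

text \<open>
  By invariance, a pair of a \<open>K\<close>-subset and a unit vector at which \<open>\<beta>\<^sub>K\<close> or \<open>\<alpha>\<^sub>K\<close> is attained can be
  moved by a signed permutation so that the vector \<open>x\<close> becomes nonnegative and nondecreasing. Rounding
  its entries to powers of \<open>\<delta>\<close> then gives some \<open>\<psi>\<^sub>r\<close> with \<open>\<langle>x, \<psi>\<^sub>r\<rangle>\<^sup>2 \<ge> 1 - \<epsilon>\<^sup>2\<close>. As \<open>x\<close> is an extremal
  eigenvector of the frame operator of the subset, the cross terms between \<open>x\<close> and the part of \<open>\<psi>\<^sub>r\<close>
  orthogonal to it vanish, which bounds the extremal value in terms of the value at \<open>\<psi>\<^sub>r\<close>.
\<close>

subsection \<open>Sums of extremal values\<close>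

text \<open>The terms over the intersection cancel. The remaining sets \<open>T - S\<close> and
  \<open>S - T\<close> have equal size, and any bijection from the first to the second weakly
  increases \<open>f\<close>.\<close>

lemma sum_le_sum_of_separated:
  fixes f :: "'a \<Rightarrow> real"
  assumes "finite S" "finite T" "card S = card T"
    and sep: "\<And>t s. t \<in> T \<Longrightarrow> s \<in> S - T \<Longrightarrow> f t \<le> f s"
  shows "sum f T \<le> sum f S"
proof -
  have card: "card (T - S) = card (S - T)"
    using assms(1-3) by (simp add: card_le_sym_Diff le_antisym)
  then obtain g where g: "bij_betw g (T - S) (S - T)"
    using assms(1,2) by (meson finite_Diff finite_same_card_bij)
  have "sum f (T - S) \<le> (\<Sum>t\<in>T - S. f (g t))"
    using g by (intro sum_mono sep) (auto dest: bij_betw_apply)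
  also have "\<dots> = sum f (S - T)"
    using g by (rule sum.reindex_bij_betw)
  finally have "sum f (T - S) \<le> sum f (S - T)" .
  then show ?thesis
    using sum.Int_Diff[OF assms(1), of f T] sum.Int_Diff[OF assms(2), of f S]
    by (simp add: Int_commute)
qed

lemma sort_map_conv_sort_key: "sort (map f xs) = map f (sort_key f xs)"
  by (rule properties_for_sort) simp_all

text \<open>Sorting the indices by \<open>f\<close>, rather than the values, lets the first
  \<open>K\<close> entries name an index set even when values repeat. Every index outside this set
  comes later in the sorted list, which is the separation needed for minimality.\<close>

lemma sum_smallest_attained:
  fixes f :: "nat \<Rightarrow> real"
  assumes "K \<le> N"
  obtains T where "T \<subseteq> {1..N}" "card T = K" "sum_smallest K (map f [1..<Suc N]) = sum f T"
    "\<And>S. S \<subseteq> {1..N} \<Longrightarrow> card S = K \<Longrightarrow> sum f T \<le> sum f S"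
proof -
  define zs where "zs = sort_key f [1..<Suc N]"
  define T where "T = set (take K zs)"
  have zs: "set zs = {1..N}" "distinct zs" "length zs = N" "sorted (map f zs)"
    by (auto simp: zs_def simp del: upt_Suc)
  have T: "T \<subseteq> {1..N}" "card T = K"
    using zs \<open>K \<le> N\<close> by (auto simp: T_def distinct_card dest: in_set_takeD)
  have "f t \<le> f s" if "t \<in> T" "s \<in> {1..N} - T" for t s
  proof -
    have "s \<in> set (drop K zs)"
      using that zs(1) by (metis Diff_iff T_def Un_iff append_take_drop_id set_append)
    moreover have "sorted (map f (take K zs) @ map f (drop K zs))"
      using zs(4) by (metis append_take_drop_id map_append)
    ultimately show ?thesis
      using that(1) by (auto simp: T_def sorted_append)
  qed
  then have "sum f T \<le> sum f S" if "S \<subseteq> {1..N}" "card S = K" for S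
    using that T by (intro sum_le_sum_of_separated) (auto intro: finite_subset)
  moreover have "sum_smallest K (map f [1..<Suc N]) = sum f T"
    using zs(2) unfolding sum_smallest_def sort_map_conv_sort_key T_def take_map zs_def[symmetric]
    by (simp add: sum.distinct_set_conv_list)
  ultimately show ?thesis using T that by blast
qed

text \<open>Negation reverses the sorted order, so the facts about the \<open>K\<close> largest
  values follow from those about the \<open>K\<close> smallest.\<close>

lemma sum_largest_eq_uminus_sum_smallest:
  "sum_largest K xs = - sum_smallest K (map uminus xs)"
proof -
  have "sort (map uminus xs) = rev (map uminus (sort xs))"
    by (rule properties_for_sort) (auto simp: sorted_wrt_rev sorted_wrt_map)
  then have "sum_smallest K (map uminus xs) = sum_list (map uminus (take K (rev (sort xs))))"
    by (simp add: sum_smallest_def rev_map take_map)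
  moreover have "sum_list (map uminus ys) = - sum_list ys" for ys :: "real list"
    by (induction ys) simp_all
  ultimately show ?thesis by (simp add: sum_largest_def)
qed

lemma sum_largest_attained:
  fixes f :: "nat \<Rightarrow> real"
  assumes "K \<le> N"
  obtains T where "T \<subseteq> {1..N}" "card T = K" "sum_largest K (map f [1..<Suc N]) = sum f T"
    "\<And>S. S \<subseteq> {1..N} \<Longrightarrow> card S = K \<Longrightarrow> sum f S \<le> sum f T"
proof (rule sum_smallest_attained[OF assms, of "\<lambda>n. - f n"])
  fix T assume T: "T \<subseteq> {1..N}" "card T = K"
    and eq: "sum_smallest K (map (\<lambda>n. - f n) [1..<Suc N]) = (\<Sum>n\<in>T. - f n)"
    and le: "\<And>S. S \<subseteq> {1..N} \<Longrightarrow> card S = K \<Longrightarrow> (\<Sum>n\<in>T. - f n) \<le> (\<Sum>n\<in>S. - f n)"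
  have "sum_largest K (map f [1..<Suc N]) = sum f T"
    unfolding sum_largest_eq_uminus_sum_smallest map_map o_def eq by (simp add: sum_negf)
  moreover have "sum f S \<le> sum f T" if "S \<subseteq> {1..N}" "card S = K" for S
    using le[OF that] by (simp add: sum_negf)
  ultimately show ?thesis using that T by blast
qed

subsection \<open>Quadratic forms at an extremal point\<close>

text \<open>The quadratic form of the frame operator of the subfamily indexed by \<open>S\<close>.
  The absolute values are kept so that unfolding yields literally the sums in the NERF
  bounds.\<close>

definition frame_form :: "(nat \<Rightarrow> 'a::real_inner) \<Rightarrow> nat set \<Rightarrow> 'a \<Rightarrow> real" where
  "frame_form \<phi> S x = (\<Sum>n\<in>S. \<bar>x \<bullet> \<phi> n\<bar>\<^sup>2)"

lemma frame_form_nonneg: "0 \<le> frame_form \<phi> S x"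
  by (simp add: frame_form_def sum_nonneg)

lemma frame_form_mono: "finite T \<Longrightarrow> S \<subseteq> T \<Longrightarrow> frame_form \<phi> S x \<le> frame_form \<phi> T x"
  by (simp add: frame_form_def sum_mono2)

lemma frame_form_scaleR: "frame_form \<phi> S (c *\<^sub>R x) = c\<^sup>2 * frame_form \<phi> S x"
  by (simp add: frame_form_def sum_distrib_left power_mult_distrib)

lemma frame_form_add_scaleR:
  "frame_form \<phi> S (y + t *\<^sub>R x) =
     frame_form \<phi> S y + 2 * t * (\<Sum>n\<in>S. (x \<bullet> \<phi> n) * (y \<bullet> \<phi> n)) + t\<^sup>2 * frame_form \<phi> S x"
  by (simp add: frame_form_def inner_add_left power2_eq_square algebra_simps
      sum.distrib sum_distrib_left)

lemma affine_nonneg_imp_constant: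
  fixes b c :: real
  assumes "\<And>t. 0 \<le> c + t * b"
  shows "b = 0"
proof (rule ccontr)
  assume "b \<noteq> 0"
  \<comment> \<open>At this \<open>t\<close> the affine function takes the value -1.\<close>
  then show False using assms[of "- (c + 1) / b"] by simp
qed

text \<open>A semidefinite form \<open>s (q - c \<parallel>\<cdot>\<parallel>\<^sup>2)\<close> vanishing at \<open>x\<close> has \<open>x\<close> in its kernel.\<close>

lemma frame_form_shift:
  assumes psd: "\<And>y. 0 \<le> s * (frame_form \<phi> S y - c * (norm y)\<^sup>2)"
    and zero: "frame_form \<phi> S x = c * (norm x)\<^sup>2" and "s \<noteq> 0"
  shows "frame_form \<phi> S (y + t *\<^sub>R x) - c * (norm (y + t *\<^sub>R x))\<^sup>2 =
    frame_form \<phi> S y - c * (norm y)\<^sup>2"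
proof -
  define b where "b = 2 * ((\<Sum>n\<in>S. (x \<bullet> \<phi> n) * (y \<bullet> \<phi> n)) - c * (x \<bullet> y))"
  \<comment> \<open>The coefficient of the square of \<open>t\<close> is the shifted form at
    \<open>x\<close>, which \<open>zero\<close> makes vanish, so only a linear term is left.
    Semidefiniteness then forces its slope to be 0.\<close>
  have shift: "frame_form \<phi> S (y + t *\<^sub>R x) - c * (norm (y + t *\<^sub>R x))\<^sup>2 =
      frame_form \<phi> S y - c * (norm y)\<^sup>2 + t * b" for t
    unfolding frame_form_add_scaleR zero b_def power2_norm_eq_inner
    by (simp add: inner_simps inner_commute power2_eq_square algebra_simps)
  have "s * b = 0"
    using psd[of "y + _ *\<^sub>R x"]
    by (intro affine_nonneg_imp_constant[of "s * (frame_form \<phi> S y - c * (norm y)\<^sup>2)"])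
      (simp add: shift algebra_simps)
  with \<open>s \<noteq> 0\<close> shift show ?thesis by simp
qed

lemma frame_form_le_of_sphere:
  assumes "\<And>y. norm y = 1 \<Longrightarrow> frame_form \<phi> S y \<le> c"
  shows "frame_form \<phi> S y \<le> c * (norm y)\<^sup>2"
proof (cases "y = 0")
  case False
  then show ?thesis
    using assms[of "y /\<^sub>R norm y"]
    by (simp add: frame_form_scaleR field_simps)
qed (simp add: frame_form_def)

lemma frame_form_ge_of_sphere:
  assumes "\<And>y. norm y = 1 \<Longrightarrow> c \<le> frame_form \<phi> S y"
  shows "c * (norm y)\<^sup>2 \<le> frame_form \<phi> S y"
proof (cases "y = 0")
  case False
  then show ?thesis
    using assms[of "y /\<^sub>R norm y"]
    by (simp add: frame_form_scaleR field_simps)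
qed (simp add: frame_form_def)

lemma norm_orthogonal_part:
  fixes x y :: "'a::real_inner"
  assumes "norm x = 1" "norm y = 1"
  shows "(norm (y - (x \<bullet> y) *\<^sub>R x))\<^sup>2 = 1 - (x \<bullet> y)\<^sup>2"
  using assms unfolding power2_norm_eq_inner inner_diff_left inner_diff_right
  by (simp add: norm_eq_1 inner_commute power2_eq_square)

text \<open>Split \<open>y\<close> into its projection on \<open>x\<close> and the orthogonal part
  \<open>w\<close>. By \<open>frame_form_shift\<close> with \<open>s = -1\<close>, the shifted form
  takes the same value at \<open>y\<close> and at \<open>w\<close>; there it is bounded below by
  discarding the nonnegative form at \<open>w\<close>.\<close>

lemma frame_form_near_maximizer:
  assumes x: "norm x = 1" and y: "norm y = 1"
    and max: "\<And>z. norm z = 1 \<Longrightarrow> frame_form \<phi> S z \<le> frame_form \<phi> S x"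
  shows "(x \<bullet> y)\<^sup>2 * frame_form \<phi> S x \<le> frame_form \<phi> S y"
proof -
  let ?b = "frame_form \<phi> S x" and ?w = "y - (x \<bullet> y) *\<^sub>R x"
  have "frame_form \<phi> S y - ?b = frame_form \<phi> S ?w - ?b * (norm ?w)\<^sup>2"
    using frame_form_shift[of "-1" \<phi> S ?b x ?w "x \<bullet> y"] frame_form_le_of_sphere[OF max] x y
    by simp
  also have "\<dots> \<ge> - ?b * (1 - (x \<bullet> y)\<^sup>2)"
    using frame_form_nonneg[of \<phi> S ?w] norm_orthogonal_part[OF x y] by simp
  finally show ?thesis by (simp add: algebra_simps)
qed

text \<open>The same splitting with \<open>s = 1\<close>. An upper bound is wanted now, so the form
  at the orthogonal part is estimated by \<open>b\<close> times its squared norm.\<close>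

lemma frame_form_near_minimizer:
  assumes x: "norm x = 1" and y: "norm y = 1"
    and min: "\<And>z. norm z = 1 \<Longrightarrow> frame_form \<phi> S x \<le> frame_form \<phi> S z"
    and upper: "\<And>z. norm z = 1 \<Longrightarrow> frame_form \<phi> S z \<le> b"
  shows "frame_form \<phi> S y \<le> (x \<bullet> y)\<^sup>2 * frame_form \<phi> S x + (1 - (x \<bullet> y)\<^sup>2) * b"
proof -
  let ?a = "frame_form \<phi> S x" and ?w = "y - (x \<bullet> y) *\<^sub>R x"
  have "frame_form \<phi> S y - ?a = frame_form \<phi> S ?w - ?a * (norm ?w)\<^sup>2"
    using frame_form_shift[of 1 \<phi> S ?a x ?w "x \<bullet> y"] frame_form_ge_of_sphere[OF min] x y
    by simp
  also have "\<dots> \<le> (b - ?a) * (1 - (x \<bullet> y)\<^sup>2)"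
    using frame_form_le_of_sphere[OF upper, of ?w]
    unfolding norm_orthogonal_part[OF x y] left_diff_distrib by simp
  finally show ?thesis by (simp add: algebra_simps)
qed

lemma unit_norm_tight_frame_form:
  fixes \<phi> :: "nat \<Rightarrow> real ^ 'm"
  assumes "unit_norm_tight_frame N \<phi>"
  shows "frame_form \<phi> {1..N} x = real N / CARD('m) * (norm x)\<^sup>2"
proof -
  obtain A where A: "(\<Sum>n = 1..N. columnvector (\<phi> n) ** (rowvector (\<phi> n) :: real ^ 'm ^ 1)) = A *\<^sub>R mat 1"
    and unit: "\<And>n. n \<in> {1..N} \<Longrightarrow> norm (\<phi> n) = 1"
    using assms by (auto simp: unit_norm_tight_frame_def)
  have entry: "(\<Sum>n = 1..N. \<phi> n $ i * \<phi> n $ j) = (if i = j then A else 0)" for i j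
    using arg_cong[OF A, of "\<lambda>B. B $ i $ j"]
    by (simp add: matrix_matrix_mult_def columnvector_def rowvector_def mat_def)
  \<comment> \<open>Comparing traces determines the frame constant: the trace of each rank-one term
    is the squared norm of a unit vector.\<close>
  have "A * CARD('m) = (\<Sum>i\<in>UNIV. \<Sum>n = 1..N. \<phi> n $ i * \<phi> n $ i)"
    by (simp add: entry del: One_nat_def)
  also have "\<dots> = (\<Sum>n = 1..N. \<phi> n \<bullet> \<phi> n)"
    by (subst sum.swap) (simp add: inner_vec_def)
  also have "\<dots> = N" using unit by (simp add: norm_eq_1)
  finally have A_eq: "A = N / CARD('m)" by (simp add: field_simps)
  have "frame_form \<phi> {1..N} x =
      (\<Sum>n = 1..N. \<Sum>i\<in>UNIV. \<Sum>j\<in>UNIV. x $ i * x $ j * (\<phi> n $ i * \<phi> n $ j))"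
    by (simp add: frame_form_def inner_vec_def power2_eq_square sum_product algebra_simps)
  also have "\<dots> = (\<Sum>i\<in>UNIV. \<Sum>n = 1..N. \<Sum>j\<in>UNIV. x $ i * x $ j * (\<phi> n $ i * \<phi> n $ j))"
    by (rule sum.swap)
  also have "\<dots> = (\<Sum>i\<in>UNIV. \<Sum>j\<in>UNIV. \<Sum>n = 1..N. x $ i * x $ j * (\<phi> n $ i * \<phi> n $ j))"
    by (intro sum.cong refl sum.swap)
  also have "\<dots> = (\<Sum>i\<in>UNIV. \<Sum>j\<in>UNIV. x $ i * x $ j * (if i = j then A else 0))"
    by (simp only: entry flip: sum_distrib_left)
  also have "\<dots> = A * (norm x)\<^sup>2"
    by (simp add: power2_norm_eq_inner inner_vec_def sum_distrib_left mult_ac if_distrib cong: if_cong)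
  finally show ?thesis by (simp add: A_eq)
qed

subsection \<open>Sorting by signed permutations\<close>

lemma ex_sorting_permutation:
  fixes f :: "'m::{finite,linorder} \<Rightarrow> real"
  obtains q where "q permutes UNIV" "mono (\<lambda>i. f (q i))"
proof -
  define xs where "xs = sorted_list_of_set (UNIV :: 'm set)"
  define zs where "zs = sort_key f xs"
  have xs: "set xs = UNIV" "sorted xs" "distinct xs"
    by (auto simp: xs_def)
  have zs: "set zs = UNIV" "sorted (map f zs)" "distinct zs" "length zs = length xs"
    using xs by (auto simp: zs_def)
  \<comment> \<open>\<open>q\<close> sends the i-th smallest index to the i-th index in the order
    given by \<open>f\<close>.\<close>
  define q where "q x = the (map_of (zip xs zs) x)" for x
  have nth: "q (xs ! i) = zs ! i" if "i < length xs" for i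
    using that xs zs by (simp add: q_def map_of_zip_nth)
  have q: "map q xs = zs" using nth zs(4) by (auto intro: nth_equalityI)
  have "surj q" using q xs(1) zs(1) by (metis set_map)
  then have perm: "q permutes UNIV"
    by (metis UNIV_I bij_def bij_imp_permutes finite_UNIV_surj_inj finite)
  have "mono (\<lambda>i. f (q i))"
  proof (rule monoI)
    fix x y :: 'm assume "x \<le> y"
    obtain i j where ij: "x = xs ! i" "i < length xs" "y = xs ! j" "j < length xs"
      using xs(1) by (metis UNIV_I in_set_conv_nth)
    show "f (q x) \<le> f (q y)"
    proof (cases "i \<le> j")
      case True
      then show ?thesis using ij nth zs(2,4) by (auto simp: sorted_iff_nth_mono)
    next
      case False
      then have "y \<le> x" using ij xs(2) by (simp add: sorted_iff_nth_mono)
      with \<open>x \<le> y\<close> show ?thesis by simp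
    qed
  qed
  with perm show ?thesis using that by blast
qed

text \<open>Column \<open>j\<close> of the permutation factor has its 1 in row \<open>p j\<close>.
  Reading the image at position \<open>p j\<close> avoids the inverse permutation.\<close>

lemma signed_permutation_matrix_nth:
  fixes U :: "real ^ 'm ^ 'm"
  assumes "signed_permutation_matrix U"
  obtains p s where "p permutes UNIV" "\<And>j. s j = 1 \<or> s j = - 1"
    "\<And>x j. (U *v x) $ p j = s j * x $ j"
proof -
  obtain P D where PD: "permutation_matrix P" "sign_diagonal_matrix D" "U = P ** D"
    using assms by (auto simp: signed_permutation_matrix_def)
  obtain p where p: "p permutes UNIV" "P = (\<chi> i j. if i = p j then 1 else 0)"
    using PD(1) by (auto simp: permutation_matrix_def)
  have D: "(D *v x) $ j = D $ j $ j * x $ j" for x j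
  proof -
    have "D $ j $ k * x $ k = (if k = j then D $ j $ j * x $ j else 0)" for k
      using PD(2) by (auto simp: sign_diagonal_matrix_def)
    then have "(\<Sum>k\<in>UNIV. D $ j $ k * x $ k) = (\<Sum>k\<in>UNIV. if k = j then D $ j $ j * x $ j else 0)"
      by (rule sum.cong[OF refl])
    then show ?thesis by (simp add: matrix_vector_mult_def)
  qed
  have "(U *v x) $ p j = D $ j $ j * x $ j" for x j
  proof -
    have "(P *v y) $ p j = y $ j" for y
      by (simp add: p(2) inj_eq[OF permutes_inj[OF p(1)]] matrix_vector_mult_def
          if_distrib[of "\<lambda>a. a * _"] cong: if_cong)
    then show ?thesis by (simp add: PD(3) D flip: matrix_vector_mul_assoc)
  qed
  with p(1) PD(2) show ?thesis
    using that[of p "\<lambda>j. D $ j $ j"] by (auto simp: sign_diagonal_matrix_def)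
qed

lemma signed_permutation_matrix_inner:
  fixes U :: "real ^ 'm ^ 'm"
  assumes "signed_permutation_matrix U"
  shows "(U *v x) \<bullet> (U *v y) = x \<bullet> y"
proof -
  obtain p s where p: "p permutes UNIV" and s: "\<And>j. s j = 1 \<or> s j = - 1"
    and U: "\<And>x j. (U *v x) $ p j = s j * x $ j"
    using signed_permutation_matrix_nth[OF assms] by metis
  have "(U *v x) \<bullet> (U *v y) = (\<Sum>j\<in>UNIV. (U *v x) $ p j * (U *v y) $ p j)"
    unfolding inner_vec_def inner_real_def
    by (rule sum.permute[OF p, unfolded o_def])
  also have "(U *v x) $ p j * (U *v y) $ p j = x $ j * y $ j" for j
    using s[of j] by (auto simp: U)
  then have "(\<Sum>j\<in>UNIV. (U *v x) $ p j * (U *v y) $ p j) = x \<bullet> y"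
    by (simp add: inner_vec_def)
  finally show ?thesis .
qed

lemma ex_sorting_signed_permutation:
  fixes x :: "real ^ 'm::{finite,linorder}"
  obtains U where "signed_permutation_matrix U" "\<And>i. 0 \<le> (U *v x) $ i" "mono (\<lambda>i. (U *v x) $ i)"
proof -
  obtain q where q: "q permutes UNIV" "mono (\<lambda>i. \<bar>x $ q i\<bar>)"
    by (rule ex_sorting_permutation[of "\<lambda>i. \<bar>x $ i\<bar>"])
  \<comment> \<open>Position \<open>i\<close> of the result should hold entry \<open>q i\<close> of
    the input. Since these matrices move entry \<open>j\<close> to position \<open>p j\<close>, the
    permutation must be \<open>inv q\<close>.\<close>
  define P where "P = (\<chi> i j. if i = inv q j then 1 else (0 :: real))"
  \<comment> \<open>Zero entries of \<open>x\<close> get the sign 1, so that the diagonal consists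
    of signs only.\<close>
  define D where "D = (\<chi> i j. if i = j then if x $ i < 0 then - 1 else 1 else (0 :: real))"
  have "signed_permutation_matrix (P ** D)"
    unfolding signed_permutation_matrix_def permutation_matrix_def sign_diagonal_matrix_def
    by (intro exI[of _ P] exI[of _ D] exI[of _ "inv q"] conjI refl)
      (auto simp: P_def D_def permutes_inv[OF q(1)])
  moreover have "((P ** D) *v x) $ i = \<bar>x $ q i\<bar>" for i
  proof -
    have D: "(D *v x) $ j = \<bar>x $ j\<bar>" for j
      by (simp add: D_def matrix_vector_mult_def if_distrib[of "\<lambda>a. a * _"] cong: if_cong)
    have "i = inv q j \<longleftrightarrow> j = q i" for j
      using permutes_inv_eq[OF q(1)] by metis
    then have "(P *v y) $ i = y $ q i" for y
      by (simp add: P_def matrix_vector_mult_def if_distrib[of "\<lambda>a. a * _"] cong: if_cong)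
    then show ?thesis by (simp add: D flip: matrix_vector_mul_assoc)
  qed
  ultimately show ?thesis using that[of "P ** D"] q(2) by simp
qed

subsection \<open>Step functions approximate sorted vectors\<close>

lemma norm_normalized_step:
  assumes "0 < \<delta>"
  shows "norm (normalized_step \<delta> \<eta> :: real ^ 'm) = 1"
proof -
  have "(\<chi> m. \<delta> ^ \<eta> m :: real ^ 'm) \<noteq> 0"
    using assms by (simp add: vec_eq_iff)
  then show ?thesis by (simp add: normalized_step_def Let_def)
qed

text \<open>The step function is obtained by rounding each entry of \<open>x\<close> up to the nearest power of \<open>\<delta>\<close>.
  Hence \<open>\<langle>x, h\<rangle> \<ge> \<parallel>x\<parallel>\<^sup>2\<close>, while \<open>\<parallel>h\<parallel>\<^sup>2 \<le> \<delta>\<^sup>-\<^sup>2 (1 + M \<delta>\<^sup>2\<^sup>L) = \<delta>\<^sup>-\<^sup>2 L / (L - 1)\<close>.\<close>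

lemma ex_normalized_step_near:
  fixes x :: "real ^ 'm::{finite,linorder}"
  assumes x: "norm x = 1" and nonneg: "\<And>i. 0 \<le> x $ i" and mono: "mono (\<lambda>i. x $ i)"
    and \<delta>: "0 < \<delta>" and L: "2 \<le> L"
    and power: "real CARD('m) * (real L - 1) * \<delta> ^ (2 * L) = 1"
  obtains \<eta> where "\<eta> \<in> step_exponents L" "\<delta>\<^sup>2 * ((real L - 1) / real L) \<le> (x \<bullet> normalized_step \<delta> \<eta>)\<^sup>2"
proof -
  \<comment> \<open>The admissible exponents for entry \<open>m\<close>; the largest one is the
    tightest rounding up. Exponent 0 always qualifies because entries of a unit vector are at most
    1.\<close>
  define E where "E m = {l. l \<le> L - 1 \<and> x $ m \<le> \<delta> ^ l}" for m
  define \<eta> where "\<eta> m = Max (E m)" for m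
  have "x $ m \<le> 1" for m
    using component_le_norm_cart[of x m] x by simp
  then have E: "finite (E m)" "E m \<noteq> {}" for m
    by (auto simp: E_def intro!: exI[of _ 0])
  have in_E: "\<eta> m \<in> E m" for m
    unfolding \<eta>_def by (rule Max_in[OF E])
  \<comment> \<open>A larger entry admits fewer exponents.\<close>
  have "antimono \<eta>"
    unfolding \<eta>_def using E monoD[OF mono]
    by (intro antimonoI Max_mono) (auto simp: E_def intro: order_trans)
  then have step: "\<eta> \<in> step_exponents L"
    using in_E by (auto simp: step_exponents_def E_def)
  define h where "h = (\<chi> m. \<delta> ^ \<eta> m)"
  have "x \<bullet> x \<le> x \<bullet> h"
    using in_E nonneg unfolding inner_vec_def h_def E_def
    by (auto intro!: sum_mono mult_left_mono)
  then have inner_h: "1 \<le> x \<bullet> h" using x by (simp add: norm_eq_1)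
  \<comment> \<open>Either the exponent is capped at \<open>L - 1\<close>, and one more factor
    \<delta> gives exactly \<open>\<delta> ^ L\<close>, or the next exponent is inadmissible, so
    that one more factor \<delta> drops below \<open>x $ m\<close>. Adding both bounds avoids
    keeping track of which case occurs at which entry.\<close>
  have entry: "\<delta>\<^sup>2 * (h $ m)\<^sup>2 \<le> (x $ m)\<^sup>2 + \<delta> ^ (2 * L)" for m
  proof (cases "\<eta> m = L - 1")
    case True
    then have "\<delta> * h $ m = \<delta> ^ L"
      using L by (simp add: h_def flip: power_Suc)
    then have "\<delta>\<^sup>2 * (h $ m)\<^sup>2 = \<delta> ^ (2 * L)"
      by (metis power_even_eq power_mult_distrib)
    then show ?thesis by simp
  next
    case False
    have "Suc (\<eta> m) \<notin> E m"
      unfolding \<eta>_def using E(1)[of m] Max_ge Suc_n_not_le_n by blast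
    moreover have "Suc (\<eta> m) \<le> L - 1" using False in_E[of m] by (auto simp: E_def)
    ultimately have "\<delta> * h $ m \<le> x $ m" by (simp add: E_def h_def)
    then have "(\<delta> * h $ m)\<^sup>2 \<le> (x $ m)\<^sup>2"
      using \<delta> by (intro power_mono) (auto simp: h_def)
    then show ?thesis using \<delta> by (simp add: power_mult_distrib add_increasing2)
  qed
  have "\<delta>\<^sup>2 * (norm h)\<^sup>2 = (\<Sum>m\<in>UNIV. \<delta>\<^sup>2 * (h $ m)\<^sup>2)"
    unfolding power2_norm_eq_inner inner_vec_def sum_distrib_left by (simp add: power2_eq_square)
  also have "\<dots> \<le> (\<Sum>m\<in>UNIV. (x $ m)\<^sup>2 + \<delta> ^ (2 * L))"
    by (intro sum_mono entry)
  also have "\<dots> = (norm x)\<^sup>2 + real CARD('m) * \<delta> ^ (2 * L)"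
    unfolding power2_norm_eq_inner inner_vec_def by (simp add: sum.distrib power2_eq_square)
  also have "real CARD('m) * \<delta> ^ (2 * L) = 1 / (real L - 1)"
    using L power by (simp add: field_simps)
  finally have "\<delta>\<^sup>2 * (norm h)\<^sup>2 \<le> real L / (real L - 1)"
    using L x by (simp add: field_simps)
  then have norm_h: "\<delta>\<^sup>2 * ((real L - 1) / real L) * (norm h)\<^sup>2 \<le> 1"
    using L by (simp add: field_simps)
  have "h \<noteq> 0" using inner_h by auto
  have eq: "normalized_step \<delta> \<eta> = h /\<^sub>R norm h"
    by (simp add: normalized_step_def h_def Let_def)
  have "(1::real) \<le> (x \<bullet> h)\<^sup>2" using inner_h by simp
  with norm_h have "\<delta>\<^sup>2 * ((real L - 1) / real L) * (norm h)\<^sup>2 \<le> (x \<bullet> h)\<^sup>2" by linarith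
  moreover have "(x \<bullet> normalized_step \<delta> \<eta>)\<^sup>2 = (x \<bullet> h)\<^sup>2 / (norm h)\<^sup>2"
    by (simp add: eq power_mult_distrib power_inverse divide_inverse mult.commute)
  ultimately have "\<delta>\<^sup>2 * ((real L - 1) / real L) \<le> (x \<bullet> normalized_step \<delta> \<eta>)\<^sup>2"
    using \<open>h \<noteq> 0\<close> by (simp only: pos_le_divide_eq zero_less_power zero_less_norm_iff not_False_eq_True)
  with step show ?thesis using that by blast
qed

text \<open>The choice of \<delta> turns \<open>1 / (M * (L - 1))\<close> into
  \<open>\<delta> ^ (2 * L)\<close>. After division by \<open>L - 1\<close>, the hypothesis on
  \<epsilon> compares two L-th powers, and taking roots gives the accuracy required of the
  rounding.\<close>

lemma step_parameter:
  fixes M L :: nat and \<epsilon> \<delta> :: real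
  assumes "0 < M" "2 \<le> L" "0 < \<epsilon>" "\<epsilon> < 1"
    and le: "(real L - 1) * (1 - \<epsilon>\<^sup>2) ^ L \<le> 1 / real M * ((real L - 1) / real L) ^ L"
    and \<delta>: "\<delta> = (real M * (real L - 1)) powr (- 1 / (2 * real L))"
  shows "0 < \<delta>" "real M * (real L - 1) * \<delta> ^ (2 * L) = 1"
    "1 - \<epsilon>\<^sup>2 \<le> \<delta>\<^sup>2 * ((real L - 1) / real L)"
proof -
  have pos: "0 < real M * (real L - 1)" using assms by simp
  then show "0 < \<delta>" unfolding \<delta> powr_gt_zero by (metis less_irrefl)
  have "\<delta> ^ (2 * L) = \<delta> powr (2 * real L)"
    using \<open>0 < \<delta>\<close> by (simp flip: powr_realpow)
  also have "\<dots> = (real M * (real L - 1)) powr (- 1)"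
    using assms(2) by (simp add: \<delta> powr_powr)
  also have "\<dots> = 1 / (real M * (real L - 1))"
    using pos by (simp add: powr_minus_divide)
  finally have power: "\<delta> ^ (2 * L) = 1 / (real M * (real L - 1))" .
  with pos show "real M * (real L - 1) * \<delta> ^ (2 * L) = 1"
    by (simp only: times_divide_eq_right mult_1_right divide_self less_imp_neq[symmetric] not_False_eq_True)
  have "(1 - \<epsilon>\<^sup>2) ^ L \<le> \<delta> ^ (2 * L) * ((real L - 1) / real L) ^ L"
    using le assms(1,2) unfolding power by (simp add: field_simps)
  also have "\<dots> = (\<delta>\<^sup>2 * ((real L - 1) / real L)) ^ L"
    by (simp only: power_mult_distrib power_mult)
  \<comment> \<open>The exponent is written as a successor to match
    \<open>power_le_imp_le_base\<close>.\<close>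
  finally have "(1 - \<epsilon>\<^sup>2) ^ Suc (L - 1) \<le> (\<delta>\<^sup>2 * ((real L - 1) / real L)) ^ Suc (L - 1)"
    using assms(2) by (simp only: Suc_diff_1)
  then show "1 - \<epsilon>\<^sup>2 \<le> \<delta>\<^sup>2 * ((real L - 1) / real L)"
    by (rule power_le_imp_le_base) (use assms(2) in simp)
qed

subsection \<open>NERF bounds\<close>

lemma frame_form_bdd_above:
  fixes \<phi> :: "nat \<Rightarrow> real ^ 'm"
  shows "bdd_above (frame_form \<phi> S ` sphere 0 1)"
proof -
  have "continuous_on (sphere 0 1) (frame_form \<phi> S)"
    unfolding frame_form_def by (intro continuous_intros)
  then show ?thesis
    by (intro bounded_imp_bdd_above compact_imp_bounded compact_continuous_image) auto
qed

lemma frame_form_bdd_below: "bdd_below (frame_form \<phi> S ` A)"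
  by (rule bdd_belowI[of _ 0]) (auto simp: frame_form_nonneg)

lemma finite_card_subsets: "finite {S. S \<subseteq> {1..N::nat} \<and> card S = K}"
  by (rule finite_subset[of _ "Pow {1..N}"]) auto

lemma card_subsets_nonempty:
  assumes "K \<le> N"
  shows "{S. S \<subseteq> {1..N::nat} \<and> card S = K} \<noteq> {}"
  using obtain_subset_with_card_n[of K "{1..N}"] assms by auto

lemma frame_form_le_nerf_upper:
  fixes \<phi> :: "nat \<Rightarrow> real ^ 'm"
  assumes "S \<subseteq> {1..N}" "card S = K" "norm x = 1"
  shows "frame_form \<phi> S x \<le> nerf_upper N \<phi> K"
proof -
  have "frame_form \<phi> S x \<le> (SUP x\<in>sphere 0 1. frame_form \<phi> S x)"
    using assms by (intro cSUP_upper frame_form_bdd_above) simp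
  also have "\<dots> \<le> nerf_upper N \<phi> K"
    unfolding nerf_upper_def frame_form_def
    using assms by (intro Max_ge finite_imageI finite_card_subsets) auto
  finally show ?thesis .
qed

lemma nerf_lower_le_frame_form:
  fixes \<phi> :: "nat \<Rightarrow> real ^ 'm"
  assumes "S \<subseteq> {1..N}" "card S = K" "norm x = 1"
  shows "nerf_lower N \<phi> K \<le> frame_form \<phi> S x"
proof -
  have "nerf_lower N \<phi> K \<le> (INF x\<in>sphere 0 1. frame_form \<phi> S x)"
    unfolding nerf_lower_def frame_form_def
    using assms by (intro Min_le finite_imageI finite_card_subsets) auto
  also have "\<dots> \<le> frame_form \<phi> S x"
    using assms by (intro cINF_lower frame_form_bdd_below) simp
  finally show ?thesis .
qed

text \<open>An actual extremal vector is needed, since the estimate at nearby vectors relies on the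
  cross terms vanishing at an extremum.\<close>

lemma nerf_upper_attained:
  fixes \<phi> :: "nat \<Rightarrow> real ^ 'm"
  assumes "K \<le> N"
  obtains S x where "S \<subseteq> {1..N}" "card S = K" "norm x = 1" "nerf_upper N \<phi> K = frame_form \<phi> S x"
proof -
  have "nerf_upper N \<phi> K \<in> (\<lambda>S. SUP x\<in>sphere 0 1. \<Sum>n\<in>S. \<bar>x \<bullet> \<phi> n\<bar>\<^sup>2) ` {S. S \<subseteq> {1..N} \<and> card S = K}"
    unfolding nerf_upper_def using card_subsets_nonempty[OF assms]
    by (intro Max_in finite_imageI finite_card_subsets) simp
  then obtain S where S: "S \<subseteq> {1..N}" "card S = K"
    and "nerf_upper N \<phi> K = (SUP x\<in>sphere 0 1. \<Sum>n\<in>S. \<bar>x \<bullet> \<phi> n\<bar>\<^sup>2)"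
    by auto
  then show ?thesis
    using nerf_sup_attained[of \<phi> S] that[OF S] by (auto simp: frame_form_def)
qed

lemma nerf_lower_attained:
  fixes \<phi> :: "nat \<Rightarrow> real ^ 'm"
  assumes "K \<le> N"
  obtains S x where "S \<subseteq> {1..N}" "card S = K" "norm x = 1" "nerf_lower N \<phi> K = frame_form \<phi> S x"
proof -
  have "nerf_lower N \<phi> K \<in> (\<lambda>S. INF x\<in>sphere 0 1. \<Sum>n\<in>S. \<bar>x \<bullet> \<phi> n\<bar>\<^sup>2) ` {S. S \<subseteq> {1..N} \<and> card S = K}"
    unfolding nerf_lower_def using card_subsets_nonempty[OF assms]
    by (intro Min_in finite_imageI finite_card_subsets) simp
  then obtain S where S: "S \<subseteq> {1..N}" "card S = K"
    and "nerf_lower N \<phi> K = (INF x\<in>sphere 0 1. \<Sum>n\<in>S. \<bar>x \<bullet> \<phi> n\<bar>\<^sup>2)"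
    by auto
  then show ?thesis
    using nerf_inf_attained[of \<phi> S] that[OF S] by (auto simp: frame_form_def)
qed

lemma frame_form_le_nerf_upper_est:
  assumes "S \<subseteq> {1..N}" "card S = K" "r \<in> {1..R}"
  shows "frame_form \<phi> S (\<psi> r) \<le> nerf_upper_est N \<phi> R \<psi> K"
proof -
  have "K \<le> N" using card_mono[of "{1..N}" S] assms by simp
  then have "frame_form \<phi> S (\<psi> r) \<le> sum_largest K (map (\<lambda>n. \<bar>\<psi> r \<bullet> \<phi> n\<bar>\<^sup>2) [1..<Suc N])"
    unfolding frame_form_def by (metis sum_largest_attained assms(1,2))
  also have "\<dots> \<le> nerf_upper_est N \<phi> R \<psi> K"
    unfolding nerf_upper_est_def using assms(3) by (intro Max_ge) auto
  finally show ?thesis .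
qed

lemma nerf_lower_est_le_frame_form:
  assumes "S \<subseteq> {1..N}" "card S = K" "r \<in> {1..R}"
  shows "nerf_lower_est N \<phi> R \<psi> K \<le> frame_form \<phi> S (\<psi> r)"
proof -
  have "nerf_lower_est N \<phi> R \<psi> K \<le> sum_smallest K (map (\<lambda>n. \<bar>\<psi> r \<bullet> \<phi> n\<bar>\<^sup>2) [1..<Suc N])"
    unfolding nerf_lower_est_def using assms(3) by (intro Min_le) auto
  also have "K \<le> N" using card_mono[of "{1..N}" S] assms by simp
  then have "sum_smallest K (map (\<lambda>n. \<bar>\<psi> r \<bullet> \<phi> n\<bar>\<^sup>2) [1..<Suc N]) \<le> frame_form \<phi> S (\<psi> r)"
    unfolding frame_form_def by (metis sum_smallest_attained assms(1,2))
  finally show ?thesis .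
qed

lemma nerf_upper_est_le_nerf_upper:
  assumes "K \<le> N" "1 \<le> R" "\<And>r. r \<in> {1..R} \<Longrightarrow> norm (\<psi> r) = 1"
  shows "nerf_upper_est N \<phi> R \<psi> K \<le> nerf_upper N \<phi> K"
  unfolding nerf_upper_est_def
proof (rule Max.boundedI)
  fix a assume "a \<in> (\<lambda>r. sum_largest K (map (\<lambda>n. \<bar>\<psi> r \<bullet> \<phi> n\<bar>\<^sup>2) [1..<Suc N])) ` {1..R}"
  then obtain r where r: "r \<in> {1..R}" "a = sum_largest K (map (\<lambda>n. \<bar>\<psi> r \<bullet> \<phi> n\<bar>\<^sup>2) [1..<Suc N])"
    by auto
  then show "a \<le> nerf_upper N \<phi> K"
    using frame_form_le_nerf_upper assms(1,3) unfolding frame_form_def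
    by (metis sum_largest_attained)
qed (use assms in auto)

lemma nerf_lower_le_nerf_lower_est:
  assumes "K \<le> N" "1 \<le> R" "\<And>r. r \<in> {1..R} \<Longrightarrow> norm (\<psi> r) = 1"
  shows "nerf_lower N \<phi> K \<le> nerf_lower_est N \<phi> R \<psi> K"
  unfolding nerf_lower_est_def
proof (rule Min.boundedI)
  fix a assume "a \<in> (\<lambda>r. sum_smallest K (map (\<lambda>n. \<bar>\<psi> r \<bullet> \<phi> n\<bar>\<^sup>2) [1..<Suc N])) ` {1..R}"
  then obtain r where r: "r \<in> {1..R}" "a = sum_smallest K (map (\<lambda>n. \<bar>\<psi> r \<bullet> \<phi> n\<bar>\<^sup>2) [1..<Suc N])"
    by auto
  then show "nerf_lower N \<phi> K \<le> a"
    using nerf_lower_le_frame_form assms(1,3) unfolding frame_form_def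
    by (metis sum_smallest_attained)
qed (use assms in auto)

text \<open>The vector and the index set move together: \<open>U\<close> preserves inner products
  and carries each frame vector to another one up to sign, and the absolute values absorb the sign.
  The new index set is the image of \<open>S\<close> under \<sigma>.\<close>

lemma frame_form_sorted_representative:
  fixes \<phi> :: "nat \<Rightarrow> real ^ 'm::{finite,linorder}"
  assumes inv: "signed_permutation_invariant N \<phi>" and S: "S \<subseteq> {1..N}"
  obtains T y where "T \<subseteq> {1..N}" "card T = card S" "frame_form \<phi> T y = frame_form \<phi> S x"
    "norm y = norm x" "\<And>i. 0 \<le> y $ i" "mono (\<lambda>i. y $ i)"
proof -
  obtain U where U: "signed_permutation_matrix U" "\<And>i. 0 \<le> (U *v x) $ i" "mono (\<lambda>i. (U *v x) $ i)"
    using ex_sorting_signed_permutation[of x] by blast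
  obtain \<sigma> where \<sigma>: "\<sigma> permutes {1..N}"
    and U\<phi>: "\<And>n. n \<in> {1..N} \<Longrightarrow> U *v \<phi> n = \<phi> (\<sigma> n) \<or> U *v \<phi> n = - \<phi> (\<sigma> n)"
    using inv U(1) unfolding signed_permutation_invariant_def by blast
  have inj: "inj_on \<sigma> S" using permutes_inj[OF \<sigma>] by (simp add: inj_on_def inj_def)
  have "\<bar>(U *v x) \<bullet> \<phi> (\<sigma> n)\<bar> = \<bar>x \<bullet> \<phi> n\<bar>" if "n \<in> S" for n
    using U\<phi>[of n] that S signed_permutation_matrix_inner[OF U(1), of x "\<phi> n"]
    by (metis abs_minus_cancel inner_minus_right subsetD)
  then have "frame_form \<phi> (\<sigma> ` S) (U *v x) = frame_form \<phi> S x"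
    unfolding frame_form_def sum.reindex[OF inj] by (intro sum.cong) (simp_all only: o_def)
  moreover have "\<sigma> ` S \<subseteq> {1..N}"
    using S permutes_in_image[OF \<sigma>] by blast
  moreover have "norm (U *v x) = norm x"
    by (simp add: norm_eq_sqrt_inner signed_permutation_matrix_inner[OF U(1)])
  ultimately show ?thesis
    using that card_image[OF inj] U(2,3) by blast
qed

theorem theorem6:
  fixes \<phi> \<psi> :: "nat \<Rightarrow> real ^ 'm::{finite,linorder}"
    and N L R K M :: nat
    and \<epsilon> \<delta> :: real
  assumes "M = CARD('m)"
    and "unit_norm_tight_frame N \<phi>"
    and "signed_permutation_invariant N \<phi>"
    and "0 < \<epsilon>" and "\<epsilon> < 1"
    and "2 \<le> L"
    and "(real L - 1) * (1 - \<epsilon>\<^sup>2) ^ L \<le> 1 / real M * ((real L - 1) / real L) ^ L"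
    and "\<delta> = (real M * (real L - 1)) powr (- 1 / (2 * real L))"
    and "R = (M + L - 1) choose (L - 1)"
    and "step_collection L \<delta> R \<psi>"
    and "M \<le> K" and "K \<le> N"
  shows "1 / (1 - \<epsilon>\<^sup>2) * (nerf_lower_est N \<phi> R \<psi> K -
           \<epsilon>\<^sup>2 * min (real N / real M) (1 / (1 - \<epsilon>\<^sup>2) * nerf_upper_est N \<phi> R \<psi> K))
         \<le> nerf_lower N \<phi> K \<and>
         nerf_lower N \<phi> K \<le> nerf_lower_est N \<phi> R \<psi> K \<and>
         nerf_upper_est N \<phi> R \<psi> K \<le> nerf_upper N \<phi> K \<and>
         nerf_upper N \<phi> K
         \<le> min (real N / real M) (1 / (1 - \<epsilon>\<^sup>2) * nerf_upper_est N \<phi> R \<psi> K)"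
proof -
  note M = assms(1) and \<epsilon> = assms(4,5) and K = assms(12)
  have "0 < M" by (simp add: M)
  note \<delta> = step_parameter[OF \<open>0 < M\<close> assms(6,4,5,7,8)]
  obtain \<eta> :: "nat \<Rightarrow> 'm \<Rightarrow> nat" where bij: "bij_betw \<eta> {1..R} (step_exponents L)"
    and \<psi>: "\<And>r. r \<in> {1..R} \<Longrightarrow> \<psi> r = normalized_step \<delta> (\<eta> r)"
    using assms(10) by (auto simp: step_collection_def)
  have norm_\<psi>: "norm (\<psi> r) = 1" if "r \<in> {1..R}" for r
    using \<psi>[OF that] norm_normalized_step[OF \<delta>(1)] by simp
  have "0 < R" using assms(6,9) by simp
  have \<epsilon>2: "0 < 1 - \<epsilon>\<^sup>2" using \<epsilon> by (simp add: power_less_one_iff)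
  \<comment> \<open>The family need only approximate nonnegative nondecreasing unit vectors;
    symmetry takes care of all others.\<close>
  have net: "\<exists>r\<in>{1..R}. 1 - \<epsilon>\<^sup>2 \<le> (y \<bullet> \<psi> r)\<^sup>2"
    if y: "norm y = 1" "\<And>i. 0 \<le> y $ i" "mono (\<lambda>i. y $ i)" for y
  proof -
    obtain \<theta> where \<theta>: "\<theta> \<in> step_exponents L"
      "\<delta>\<^sup>2 * ((real L - 1) / real L) \<le> (y \<bullet> normalized_step \<delta> \<theta>)\<^sup>2"
      using ex_normalized_step_near[OF y \<delta>(1) assms(6) \<delta>(2)[unfolded M]] by blast
    then obtain r where "r \<in> {1..R}" "\<theta> = \<eta> r"
      using bij_betw_imp_surj_on[OF bij] by blast
    with \<theta> \<delta>(3) show ?thesis by (intro bexI[of _ r]) (auto simp: \<psi>)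
  qed
  let ?\<alpha> = "nerf_lower N \<phi> K" and ?\<beta> = "nerf_upper N \<phi> K"
    and ?\<alpha>' = "nerf_lower_est N \<phi> R \<psi> K" and ?\<beta>' = "nerf_upper_est N \<phi> R \<psi> K"

  obtain S x where S: "S \<subseteq> {1..N}" "card S = K" and x: "norm x = 1" and \<beta>_eq: "?\<beta> = frame_form \<phi> S x"
    by (rule nerf_upper_attained[OF K])
  \<comment> \<open>Enlarging \<open>S\<close> to the whole index set makes the form constant on the
    unit sphere, by tightness.\<close>
  have "frame_form \<phi> S x \<le> frame_form \<phi> {1..N} x"
    by (rule frame_form_mono) (use S in auto)
  then have \<beta>_le1: "?\<beta> \<le> real N / real M"
    by (simp add: \<beta>_eq unit_norm_tight_frame_form[OF assms(2)] x M del: One_nat_def)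

  obtain T y where T: "T \<subseteq> {1..N}" "card T = K" and y: "norm y = 1" "\<And>i. 0 \<le> y $ i" "mono (\<lambda>i. y $ i)"
    and Ty: "frame_form \<phi> T y = ?\<beta>"
    using frame_form_sorted_representative[OF assms(3) S(1), of x] S(2) x \<beta>_eq by metis
  obtain r where r: "r \<in> {1..R}" "1 - \<epsilon>\<^sup>2 \<le> (y \<bullet> \<psi> r)\<^sup>2" using net[OF y] by blast
  have "(1 - \<epsilon>\<^sup>2) * ?\<beta> \<le> (y \<bullet> \<psi> r)\<^sup>2 * frame_form \<phi> T y"
    using r(2) frame_form_nonneg[of \<phi> T y] Ty by (simp add: mult_right_mono)
  \<comment> \<open>The sorted vector \<open>y\<close> still maximizes the form of \<open>T\<close>,
    because the value it attains bounds every \<open>K\<close>-subset at every unit vector.\<close>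
  also have "\<dots> \<le> frame_form \<phi> T (\<psi> r)"
    using frame_form_le_nerf_upper[OF T] Ty
    by (intro frame_form_near_maximizer y norm_\<psi> r) simp
  also have "\<dots> \<le> ?\<beta>'" by (rule frame_form_le_nerf_upper_est[OF T r(1)])
  finally have "?\<beta> \<le> 1 / (1 - \<epsilon>\<^sup>2) * ?\<beta>'"
    using \<epsilon>2 by (simp add: field_simps)
  with \<beta>_le1 have \<beta>_le: "?\<beta> \<le> min (real N / real M) (1 / (1 - \<epsilon>\<^sup>2) * ?\<beta>')" by simp

  obtain S' x' where S': "S' \<subseteq> {1..N}" "card S' = K" "norm x' = 1" "?\<alpha> = frame_form \<phi> S' x'"
    by (rule nerf_lower_attained[OF K])
  obtain T' y' where T': "T' \<subseteq> {1..N}" "card T' = K"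
    and y': "norm y' = 1" "\<And>i. 0 \<le> y' $ i" "mono (\<lambda>i. y' $ i)"
    and Ty': "frame_form \<phi> T' y' = ?\<alpha>"
    using frame_form_sorted_representative[OF assms(3) S'(1), of x'] S' by metis
  obtain r' where r': "r' \<in> {1..R}" "1 - \<epsilon>\<^sup>2 \<le> (y' \<bullet> \<psi> r')\<^sup>2" using net[OF y'] by blast
  have "?\<alpha>' \<le> frame_form \<phi> T' (\<psi> r')" by (rule nerf_lower_est_le_frame_form[OF T' r'(1)])
  also have "\<dots> \<le> (y' \<bullet> \<psi> r')\<^sup>2 * frame_form \<phi> T' y' + (1 - (y' \<bullet> \<psi> r')\<^sup>2) * ?\<beta>"
    using nerf_lower_le_frame_form[OF T'] Ty' frame_form_le_nerf_upper[OF T']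
    by (intro frame_form_near_minimizer y' norm_\<psi> r') simp_all
  \<comment> \<open>This form isolates the squared inner product. As its factor is nonnegative, it
    may be replaced by the smaller \<open>1 - \<epsilon>\<^sup>2\<close>.\<close>
  also have "\<dots> = ?\<beta> - (y' \<bullet> \<psi> r')\<^sup>2 * (?\<beta> - ?\<alpha>)"
    by (simp add: Ty' algebra_simps)
  also have "\<dots> \<le> ?\<beta> - (1 - \<epsilon>\<^sup>2) * (?\<beta> - ?\<alpha>)"
    using frame_form_le_nerf_upper[OF T' y'(1), of \<phi>] Ty' r'(2)
    by (intro diff_left_mono mult_right_mono) auto
  also have "\<dots> = (1 - \<epsilon>\<^sup>2) * ?\<alpha> + \<epsilon>\<^sup>2 * ?\<beta>" by (simp add: algebra_simps)
  \<comment> \<open>The upper estimate already proved replaces the unknown optimal upper bound by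
    computable quantities.\<close>
  also have "\<dots> \<le> (1 - \<epsilon>\<^sup>2) * ?\<alpha> + \<epsilon>\<^sup>2 * min (real N / real M) (1 / (1 - \<epsilon>\<^sup>2) * ?\<beta>')"
    using \<beta>_le by (intro add_left_mono mult_left_mono) auto
  finally have "?\<alpha>' - \<epsilon>\<^sup>2 * min (real N / real M) (1 / (1 - \<epsilon>\<^sup>2) * ?\<beta>') \<le> ?\<alpha> * (1 - \<epsilon>\<^sup>2)"
    by (simp add: mult.commute)
  then have "1 / (1 - \<epsilon>\<^sup>2) * (?\<alpha>' - \<epsilon>\<^sup>2 * min (real N / real M) (1 / (1 - \<epsilon>\<^sup>2) * ?\<beta>')) \<le> ?\<alpha>"
    using \<epsilon>2 by (simp only: times_divide_eq_left mult_1 pos_divide_le_eq)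
  moreover have "?\<alpha> \<le> ?\<alpha>'" "?\<beta>' \<le> ?\<beta>"
    using K \<open>0 < R\<close> norm_\<psi>
    by (auto intro!: nerf_lower_le_nerf_lower_est nerf_upper_est_le_nerf_upper)
  ultimately show ?thesis using \<beta>_le by blast
qed

end
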